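(* For all integers $n\ge 1$ and $m\ge 0$, the number $w_{[1]}(n,m)$ of $n$-strings that contain exactly $m$ odd runs of ones is $$w_{[1]}(n,m)=\sum_{t=0}^{\lfloor (n-2m+1)/2\rfloor}\binom{n-m-2t+1}{m}\binom{n-m-t}{t},$$ and the number $w_{[0]}(n,m)$ of $n$-strings that contain exactly $m$ nonnull even runs of ones is $$w_{[0]}(n,m)=\sum_{r=0}^{\lfloor (n-3m+1)/2\rfloor}\ \sum_{s=0}^{n-2r-3m+1}\binom{s+m}{s}\binom{s}{n-2r-s-3m+1}\binom{n-r-s-2m}{r}.$$
   Context: An $n$-string is a binary string of length $n$. A nonnull run of ones is a maximal block of consecutive ones of length at least $1$ (flanked on each side by a zero or by the start/end of the string); it is odd (even) if its length is odd (even). The strings counted may contain any number of nonnull runs of ones of the opposite parity. Binomial coefficients are defined for all integers $a,b$ by $\binom{a}{b}=a(a-1)\cdots(a-b+1)/b!$ if $a\ge b\ge 0$, and $\binom{a}{b}=0$ if $b<0$ or $a<b$. A sum whose upper limit is smaller than its lower limit is $0$.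
   Formalization: The binomial convention is changed so that binom(a,0)=1 also for negative a; with binom(-1,0)=0 as stated, the formula for w_[0](n,0) is one too small (n=1, m=0 gives 1 instead of 2). No other term of either formula is affected. *)

theory Defs
  imports Main
begin

text \<open>Binary strings are boolean lists, with \<open>True\<close> standing for the digit one. The pair \<open>(i, l)\<close>
  denotes the block of \<open>l\<close> consecutive digits starting at the (0-based) position \<open>i\<close>.\<close>

definition is_run_of_ones :: "bool list \<Rightarrow> nat \<Rightarrow> nat \<Rightarrow> bool" where
  "is_run_of_ones xs i l \<longleftrightarrow>
     1 \<le> l \<and> i + l \<le> length xs \<and>
     (\<forall>k. i \<le> k \<and> k < i + l \<longrightarrow> xs ! k) \<and>
     (i = 0 \<or> \<not> xs ! (i - 1)) \<and>
     (i + l = length xs \<or> \<not> xs ! (i + l))"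

definition num_odd_runs :: "bool list \<Rightarrow> nat" where
  "num_odd_runs xs = card {(i, l). is_run_of_ones xs i l \<and> odd l}"

definition num_even_runs :: "bool list \<Rightarrow> nat" where
  "num_even_runs xs = card {(i, l). is_run_of_ones xs i l \<and> even l}"

definition w_odd :: "nat \<Rightarrow> nat \<Rightarrow> nat" where
  "w_odd n m = card {xs :: bool list. length xs = n \<and> num_odd_runs xs = m}"

definition w_even :: "nat \<Rightarrow> nat \<Rightarrow> nat" where
  "w_even n m = card {xs :: bool list. length xs = n \<and> num_even_runs xs = m}"

text \<open>Binomial coefficients of integers, zero if \<open>b < 0\<close> or \<open>a < b\<close>, with one exception:
  \<open>binom a 0 = 1\<close> (the empty product) also for \<open>a < 0\<close>. The formula for \<open>w_even n 0\<close> needs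
  \<open>binom (-1) 0 = 1\<close>: its summand with \<open>r = 0\<close> and \<open>s = n + 1\<close> counts the all-zero string, and
  with \<open>binom (-1) 0 = 0\<close> the formula is too small by one (for \<open>n = 1\<close> it yields 1, but both
  strings of length 1 are without even runs). No other summand of either formula is affected.\<close>

definition binom :: "int \<Rightarrow> int \<Rightarrow> int" where
  "binom a b =
     (if b = 0 then 1
      else if 0 \<le> b \<and> b \<le> a then int (nat a choose nat b)
      else 0)"

end

theory Submission
  imports Defs
begin

text \<open>Append a zero to an \<open>n\<close>-string and cut it after every zero. The pieces are
  \<open>1\<^sup>k0\<close> with \<open>k \<ge> 0\<close>, so the string is the same thing as a list of numbers \<open>k\<close> (\<open>blocks\<close>),
  whose sum plus length is \<open>n + 1\<close>. The nonzero entries are the lengths of the nonnull runs, and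
  both claims become counts of lists of naturals (\<open>w_odd_blocks\<close>, \<open>w_even_blocks\<close>).

  Lists of length \<open>J\<close> with \<open>m\<close> odd entries and sum \<open>m + 2t\<close>: choose the odd positions, then
  distribute \<open>t\<close> pairs of ones over the \<open>J\<close> entries. This gives
  \<open>(J choose m) * (t + J - 1 choose t)\<close> (\<open>card_odd_lists\<close>). The size condition forces
  \<open>J = n - m - 2t + 1\<close>, and summing over \<open>t\<close> yields the first formula.

  For even runs the zero entries have to be told apart from the positive even ones. A list with
  \<open>j\<close> odd, \<open>m\<close> positive even and \<open>p\<close> zero entries is a shuffle of \<open>p\<close> zeros with a
  list of positive entries (\<open>card_insert_zeros\<close>). Subtracting one from each positive entry swaps the
  parities and leads back to the first count, now with \<open>m\<close> odd entries among \<open>j + m\<close>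
  (\<open>card_pos_lists\<close>). With \<open>s = p + j\<close> the two position choices
  \<open>(s + m choose p) * (j + m choose m)\<close> equal \<open>(s + m choose s) * (s choose j)\<close>
  (\<open>card_even_lists\<close>); the size condition forces \<open>j = n - 2r - s - 3m + 1\<close>, and summing over
  the number \<open>r\<close> of pairs and over \<open>s\<close> yields the second formula.\<close>

section \<open>Strings as lists of run lengths\<close>

text \<open>The last entry belongs to the appended zero, so the value is never empty and a string that
  ends in zero has a final entry \<open>0\<close>. The empty branch of the case expression is
  therefore a dummy value.\<close>

fun blocks :: "bool list \<Rightarrow> nat list" where
  "blocks [] = [0]"
| "blocks (False # xs) = 0 # blocks xs"
| "blocks (True # xs) = (case blocks xs of [] \<Rightarrow> [] | k # ks \<Rightarrow> Suc k # ks)"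

lemma blocks_nonempty: "blocks xs \<noteq> []"
  by (induction xs rule: blocks.induct) (auto split: list.splits)

lemma blocks_size: "sum_list (blocks xs) + length (blocks xs) = Suc (length xs)"
proof (induction xs rule: blocks.induct)
  case (3 xs)
  then show ?case by (cases "blocks xs") (use blocks_nonempty[of xs] in auto)
qed auto

lemma inj_blocks: "inj blocks"
proof (rule injI)
  fix xs ys show "blocks xs = blocks ys \<Longrightarrow> xs = ys"
  proof (induction xs arbitrary: ys rule: blocks.induct)
    case 1
    then show ?case
      by (cases ys rule: blocks.cases)
        (auto simp: blocks_nonempty blocks_nonempty[symmetric] split: list.splits)
  next
    case (2 xs)
    then show ?case
      by (cases ys rule: blocks.cases) (auto simp: blocks_nonempty split: list.splits)
  next
    case (3 xs)
    then show ?case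
      using blocks_nonempty[of xs] blocks_nonempty
      by (cases ys rule: blocks.cases) (auto split: list.splits)
  qed
qed

lemma blocks_surj: "ks \<noteq> [] \<Longrightarrow> \<exists>xs. blocks xs = ks"
proof (induction "sum_list ks + length ks" arbitrary: ks rule: less_induct)
  case less
  then obtain k ls where ks: "ks = k # ls" by (cases ks) auto
  show ?case
  proof (cases k)
    case 0
    show ?thesis
    proof (cases "ls = []")
      case True
      then have "blocks [] = ks" using ks 0 by simp
      then show ?thesis ..
    next
      case False
      then obtain xs where "blocks xs = ls" using less(1)[of ls] ks by auto
      then have "blocks (False # xs) = ks" using ks 0 by simp
      then show ?thesis ..
    qed
  next
    case (Suc k')
    then obtain xs where "blocks xs = k' # ls" using less(1)[of "k' # ls"] ks by auto
    then have "blocks (True # xs) = ks" using ks Suc by simp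
    then show ?thesis ..
  qed
qed

lemma bij_betw_blocks:
  "bij_betw blocks {xs. length xs = n \<and> Q (blocks xs)}
     {ks. sum_list ks + length ks = Suc n \<and> Q ks}"
proof (rule bij_betw_imageI)
  show "inj_on blocks {xs. length xs = n \<and> Q (blocks xs)}"
    using inj_blocks by (rule inj_on_subset) simp
  have "\<exists>xs. length xs = n \<and> blocks xs = ks" if "sum_list ks + length ks = Suc n" for ks
  proof -
    from that have "ks \<noteq> []" by auto
    then obtain xs where "blocks xs = ks" using blocks_surj by blast
    then show ?thesis using blocks_size[of xs] that by auto
  qed
  then show "blocks ` {xs. length xs = n \<and> Q (blocks xs)}
      = {ks. sum_list ks + length ks = Suc n \<and> Q ks}"
    using blocks_size by (fastforce simp: image_iff)
qed

lemma blocks_replicate: "blocks (replicate k True) = [k]"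
  by (induction k) auto

lemma blocks_replicate_append:
  "blocks (replicate k True @ False # xs) = k # blocks xs"
  by (induction k) auto

text \<open>Runs are given by positions, while \<open>blocks\<close> recurses over single digits. Splitting off
  a whole initial block of ones is the step on which both behave simply.\<close>

lemma first_run_cases:
  obtains k where "xs = replicate k True"
  | k ys where "xs = replicate k True @ False # ys"
proof -
  have "takeWhile id xs = replicate (length (takeWhile id xs)) True"
    by (rule replicate_eqI) (auto dest: set_takeWhileD)
  then have xs: "xs = replicate (length (takeWhile id xs)) True @ dropWhile id xs"
    by (metis takeWhile_dropWhile_id)
  show thesis
  proof (cases "dropWhile id xs")
    case Nil
    then show thesis using xs that(1) by (metis append_Nil2)
  next
    case (Cons b ys)
    then have "b = False" using hd_dropWhile[of id xs] by simp
    then show thesis using xs Cons that(2) by metis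
  qed
qed

lemma is_run_replicate:
  "is_run_of_ones (replicate k True) i l \<longleftrightarrow> 1 \<le> k \<and> i = 0 \<and> l = k"
  unfolding is_run_of_ones_def by (cases i; cases "l < k") auto

lemma is_run_replicate_append:
  "is_run_of_ones (replicate k True @ False # xs) i l \<longleftrightarrow>
     1 \<le> k \<and> i = 0 \<and> l = k \<or> (\<exists>i'. i = i' + Suc k \<and> is_run_of_ones xs i' l)"
  (is "is_run_of_ones ?zs i l \<longleftrightarrow> ?R")
proof -
  have nth: "?zs ! q = (q < k \<or> (k < q \<and> xs ! (q - Suc k)))" for q
  proof -
    consider "q < k" | "q = k" | q' where "q = q' + Suc k"
      by (metis add.commute less_imp_Suc_add linorder_neqE_nat add_Suc_right)
    then show ?thesis by cases (auto simp: nth_append)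
  qed
  show ?thesis
  proof
    assume run: "is_run_of_ones ?zs i l"
    then have l: "1 \<le> l" and len: "i + l \<le> length ?zs"
      and ones: "\<And>q. i \<le> q \<Longrightarrow> q < i + l \<Longrightarrow> ?zs ! q"
      and left: "i = 0 \<or> \<not> ?zs ! (i - 1)"
      and right: "i + l = length ?zs \<or> \<not> ?zs ! (i + l)"
      unfolding is_run_of_ones_def by auto
    show ?R
    proof (cases "i \<le> k")
      case True
      have "i \<noteq> k" using ones[of k] l nth[of k] by auto
      then have "i < k" using True by simp
      then have "i = 0" using left nth[of "i - 1"] by auto
      moreover have "l \<le> k" using ones[of k] nth[of k] \<open>i = 0\<close> by force
      moreover have "\<not> l < k" using right nth[of l] \<open>i = 0\<close> by auto
      ultimately show ?thesis using l by auto
    next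
      case False
      then obtain i' where i: "i = i' + Suc k"
        by (metis add.commute le_add_diff_inverse not_less_eq_eq)
      have "is_run_of_ones xs i' l"
        unfolding is_run_of_ones_def
      proof (intro conjI allI impI)
        show "1 \<le> l" by (rule l)
        show "i' + l \<le> length xs" using len i by simp
        show "xs ! q" if "i' \<le> q \<and> q < i' + l" for q
          using ones[of "q + Suc k"] nth[of "q + Suc k"] that i by simp
        show "i' = 0 \<or> \<not> xs ! (i' - 1)"
          using left nth[of "i - 1"] i by (cases i') auto
        show "i' + l = length xs \<or> \<not> xs ! (i' + l)"
          using right nth[of "i + l"] i by auto
      qed
      then show ?thesis using i by auto
    qed
  next
    assume ?R
    then show "is_run_of_ones ?zs i l"
    proof (elim disjE exE conjE)
      assume "1 \<le> k" "i = 0" "l = k"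
      then show ?thesis unfolding is_run_of_ones_def using nth by auto
    next
      fix i' assume i: "i = i' + Suc k" and run: "is_run_of_ones xs i' l"
      show ?thesis
        unfolding is_run_of_ones_def
      proof (intro conjI allI impI)
        show "1 \<le> l" "i + l \<le> length ?zs"
          using run i unfolding is_run_of_ones_def by auto
        show "?zs ! q" if "i \<le> q \<and> q < i + l" for q
        proof -
          have "i' \<le> q - Suc k \<and> q - Suc k < i' + l" using that i by auto
          then show ?thesis using run that i nth[of q] unfolding is_run_of_ones_def by auto
        qed
        show "i = 0 \<or> \<not> ?zs ! (i - 1)"
          using run i nth[of "i - 1"] unfolding is_run_of_ones_def by (cases i') auto
        show "i + l = length ?zs \<or> \<not> ?zs ! (i + l)"
          using run i nth[of "i + l"] unfolding is_run_of_ones_def by auto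
      qed
    qed
  qed
qed

text \<open>Finiteness is part of the induction because otherwise the cardinality of the shifted set,
  to which the first run is added, could be the default value \<open>0\<close>.\<close>

lemma card_runs:
  "finite {(i, l). is_run_of_ones xs i l \<and> P l} \<and>
   card {(i, l). is_run_of_ones xs i l \<and> P l} = length (filter (\<lambda>k. 1 \<le> k \<and> P k) (blocks xs))"
proof (induction "length xs" arbitrary: xs rule: less_induct)
  case less
  let ?runs = "\<lambda>xs. {(i, l). is_run_of_ones xs i l \<and> P l}"
  show ?case
  proof (cases xs rule: first_run_cases)
    case (1 k)
    have "?runs xs = (if 1 \<le> k \<and> P k then {(0, k)} else {})"
      unfolding 1 is_run_replicate by auto
    then show ?thesis by (simp add: 1 blocks_replicate)
  next
    case (2 k ys)
    let ?shift = "\<lambda>(i, l). (i + Suc k, l)"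
    have IH: "finite (?runs ys)"
      "card (?runs ys) = length (filter (\<lambda>k. 1 \<le> k \<and> P k) (blocks ys))"
      using less[of ys] 2 by auto
    have runs: "?runs xs = (if 1 \<le> k \<and> P k then {(0, k)} else {}) \<union> ?shift ` ?runs ys"
      unfolding 2 is_run_replicate_append by (auto simp: image_iff)
    have "inj_on ?shift (?runs ys)" by (auto simp: inj_on_def)
    then have "card (?shift ` ?runs ys) = card (?runs ys)" by (rule card_image)
    moreover have "(0, k) \<notin> ?shift ` ?runs ys" by auto
    ultimately show ?thesis
      unfolding runs using IH by (auto simp: 2 blocks_replicate_append)
  qed
qed

abbreviation odds :: "nat list \<Rightarrow> nat" where
  "odds ks \<equiv> length (filter odd ks)"

abbreviation evens :: "nat list \<Rightarrow> nat" where
  "evens ks \<equiv> length (filter (\<lambda>k. 1 \<le> k \<and> even k) ks)"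

lemma w_odd_blocks:
  "w_odd n m = card {ks. sum_list ks + length ks = Suc n \<and> odds ks = m}"
proof -
  have "(\<lambda>k::nat. 1 \<le> k \<and> odd k) = odd" by (auto simp: fun_eq_iff Suc_le_eq odd_pos)
  then have "num_odd_runs xs = odds (blocks xs)" for xs
    unfolding num_odd_runs_def using card_runs[of xs odd] by simp
  then show ?thesis
    unfolding w_odd_def using bij_betw_blocks[of n "\<lambda>ks. odds ks = m"]
    by (simp add: bij_betw_same_card)
qed

lemma w_even_blocks:
  "w_even n m = card {ks. sum_list ks + length ks = Suc n \<and> evens ks = m}"
proof -
  have "num_even_runs xs = evens (blocks xs)" for xs
    unfolding num_even_runs_def using card_runs[of xs even] by simp
  then show ?thesis
    unfolding w_even_def using bij_betw_blocks[of n "\<lambda>ks. evens ks = m"]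
    by (simp add: bij_betw_same_card)
qed

section \<open>Counting lists by their odd entries\<close>

lemma finite_lists_sum:
  "finite {ks :: nat list. sum_list ks \<le> N \<and> length ks = l \<and> Q ks}"
proof (rule finite_subset)
  show "finite {ks :: nat list. set ks \<subseteq> {..N} \<and> length ks = l}"
    by (rule finite_lists_length_eq) simp
  show "{ks. sum_list ks \<le> N \<and> length ks = l \<and> Q ks}
      \<subseteq> {ks. set ks \<subseteq> {..N} \<and> length ks = l}"
    using member_le_sum_list order_trans by fastforce
qed

lemma finite_block_lists:
  "finite {ks :: nat list. sum_list ks + length ks = N \<and> Q ks}"
proof (rule finite_subset)
  show "{ks. sum_list ks + length ks = N \<and> Q ks}
      \<subseteq> (\<Union>l\<in>{..N}. {ks. sum_list ks \<le> N \<and> length ks = l \<and> True})"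
    by auto
  show "finite (\<Union>l\<in>{..N}. {ks :: nat list. sum_list ks \<le> N \<and> length ks = l \<and> True})"
    by (intro finite_UN_I finite_atMost finite_lists_sum)
qed

definition odd_lists :: "nat \<Rightarrow> nat \<Rightarrow> nat \<Rightarrow> nat list set" where
  "odd_lists J m t = {ks. length ks = J \<and> odds ks = m \<and> sum_list ks = m + 2 * t}"

lemma finite_odd_lists: "finite (odd_lists J m t)"
  by (rule finite_subset[OF _ finite_lists_sum[of "m + 2 * t" J "\<lambda>_. True"]])
    (auto simp: odd_lists_def)

text \<open>A first entry \<open>0\<close> or \<open>1\<close> is removed; from a larger one a pair is removed, which keeps all
  parities. This is Pascal's rule in the variables \<open>J\<close> and \<open>m\<close>, and for the pairs in \<open>J\<close>
  and \<open>t\<close>.\<close>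

lemma odd_lists_Suc:
  "odd_lists (Suc J) m t =
     (#) 0 ` odd_lists J m t
     \<union> (if m = 0 then {} else (#) 1 ` odd_lists J (m - 1) t)
     \<union> (if t = 0 then {} else (\<lambda>ks. (hd ks + 2) # tl ks) ` odd_lists (Suc J) m (t - 1))"
  (is "?L = ?A \<union> ?B \<union> ?C")
proof
  show "?L \<subseteq> ?A \<union> ?B \<union> ?C"
  proof
    fix ks assume ks: "ks \<in> ?L"
    then obtain k ls where kl: "ks = k # ls" by (cases ks) (auto simp: odd_lists_def)
    consider "k = 0" | "k = 1" | k' where "k = k' + 2"
      by (metis One_nat_def add_2_eq_Suc' not0_implies_Suc)
    then show "ks \<in> ?A \<union> ?B \<union> ?C"
    proof cases
      case 1
      then show ?thesis using ks kl by (auto simp: odd_lists_def)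
    next
      case 2
      then show ?thesis using ks kl by (auto simp: odd_lists_def)
    next
      case 3
      have "odds ls \<le> sum_list ls" by (induction ls) (auto simp: odd_pos Suc_le_eq intro: add_less_le_mono elim!: oddE)
      then have "t \<noteq> 0" using ks kl 3 by (auto simp: odd_lists_def split: if_splits)
      moreover have "k' # ls \<in> odd_lists (Suc J) m (t - 1)"
        using ks kl 3 \<open>t \<noteq> 0\<close> by (auto simp: odd_lists_def split: if_splits)
      moreover have "ks = (hd (k' # ls) + 2) # tl (k' # ls)" using kl 3 by simp
      ultimately have "ks \<in> ?C" unfolding if_not_P[OF \<open>t \<noteq> 0\<close>] by (intro image_eqI)
      then show ?thesis ..
    qed
  qed
  have "(hd ks + 2) # tl ks \<in> ?L" if "ks \<in> odd_lists (Suc J) m (t - 1)" "t \<noteq> 0" for ks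
    using that by (cases ks) (auto simp: odd_lists_def split: if_splits)
  then show "?A \<union> ?B \<union> ?C \<subseteq> ?L"
    by (auto simp: odd_lists_def)
qed

lemma card_odd_lists_Suc:
  "card (odd_lists (Suc J) m t) =
     card (odd_lists J m t)
     + (if m = 0 then 0 else card (odd_lists J (m - 1) t))
     + (if t = 0 then 0 else card (odd_lists (Suc J) m (t - 1)))"
proof -
  let ?A = "(#) 0 ` odd_lists J m t"
  let ?B = "if m = 0 then {} else (#) 1 ` odd_lists J (m - 1) t"
  let ?bump = "\<lambda>ks :: nat list. (hd ks + 2) # tl ks"
  let ?C = "if t = 0 then {} else ?bump ` odd_lists (Suc J) m (t - 1)"
  have "inj_on ?bump (odd_lists (Suc J) m (t - 1))"
  proof (rule inj_onI)
    fix ks ls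
    assume "ks \<in> odd_lists (Suc J) m (t - 1)" "ls \<in> odd_lists (Suc J) m (t - 1)"
      and "?bump ks = ?bump ls"
    then show "ks = ls" by (cases ks; cases ls) (simp_all add: odd_lists_def)
  qed
  then have "card ?C = (if t = 0 then 0 else card (odd_lists (Suc J) m (t - 1)))"
    by (simp add: card_image)
  moreover have "card ?A = card (odd_lists J m t)"
    "card ?B = (if m = 0 then 0 else card (odd_lists J (m - 1) t))"
    by (auto simp: card_image)
  moreover have "card (?A \<union> ?B \<union> ?C) = card ?A + card ?B + card ?C"
  proof -
    have "card (?A \<union> ?B) = card ?A + card ?B"
      by (rule card_Un_disjoint) (auto simp: finite_odd_lists)
    moreover have "card ((?A \<union> ?B) \<union> ?C) = card (?A \<union> ?B) + card ?C"
      by (rule card_Un_disjoint) (auto simp: finite_odd_lists)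
    ultimately show ?thesis by simp
  qed
  moreover have "card (odd_lists (Suc J) m t) = card (?A \<union> ?B \<union> ?C)"
    by (rule arg_cong[OF odd_lists_Suc])
  ultimately show ?thesis by linarith
qed

text \<open>With truncated subtraction the second factor for \<open>J = 0\<close> is \<open>1\<close> if \<open>t = 0\<close> and \<open>0\<close>
  otherwise, as it must be for distributing \<open>t\<close> pairs over no entries.\<close>

lemma card_odd_lists: "card (odd_lists J m t) = (J choose m) * ((t + J - 1) choose t)"
proof (induction J arbitrary: m t)
  case 0
  have "odd_lists 0 m t = (if m = 0 \<and> t = 0 then {[]} else {})"
    by (auto simp: odd_lists_def)
  then show ?case by (cases t) auto
next
  case (Suc J)
  note outer = Suc.IH
  show ?case
  proof (induction t)
    case 0
    show ?case using outer by (subst card_odd_lists_Suc) (cases m; simp)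
  next
    case (Suc t)
    have "(Suc J choose m) = (J choose m) + (if m = 0 then 0 else J choose (m - 1))"
      by (cases m) auto
    then have "card (odd_lists (Suc J) m (Suc t)) =
        (Suc J choose m) * ((t + J) choose Suc t) + (Suc J choose m) * ((t + J) choose t)"
      by (subst card_odd_lists_Suc) (simp add: Suc.IH outer algebra_simps)
    then show ?case by (simp add: algebra_simps)
  qed
qed

section \<open>Inserting the zero entries\<close>

definition pos_lists :: "nat \<Rightarrow> nat \<Rightarrow> nat \<Rightarrow> nat list set" where
  "pos_lists j m r =
     {ks. 0 \<notin> set ks \<and> odds ks = j \<and> evens ks = m \<and> sum_list ks = j + 2 * m + 2 * r}"

text \<open>Adding one to every entry is a bijection from lists with \<open>m\<close> odd and \<open>j\<close> even entries
  onto positive lists with \<open>m\<close> even and \<open>j\<close> odd entries.\<close>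

lemma card_pos_lists:
  "card (pos_lists j m r) = ((j + m) choose m) * ((r + (j + m) - 1) choose r)"
proof -
  have shift: "odds (map Suc ks) + odds ks = length ks" "evens (map Suc ks) = odds ks"
    "sum_list (map Suc ks) = sum_list ks + length ks" for ks
    by (induction ks) auto
  have "pos_lists j m r = map Suc ` odd_lists (j + m) m r"
  proof
    show "map Suc ` odd_lists (j + m) m r \<subseteq> pos_lists j m r"
    proof
      fix ls assume "ls \<in> map Suc ` odd_lists (j + m) m r"
      then obtain ks where "ks \<in> odd_lists (j + m) m r" "ls = map Suc ks" by blast
      then show "ls \<in> pos_lists j m r"
        using shift[of ks] by (auto simp: pos_lists_def odd_lists_def simp del: filter_map)
    qed
    show "pos_lists j m r \<subseteq> map Suc ` odd_lists (j + m) m r"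
    proof
      fix ls assume ls: "ls \<in> pos_lists j m r"
      define ks where "ks = map (\<lambda>k. k - 1) ls"
      have eq: "ls = map Suc ks"
        unfolding ks_def map_map using ls
        by (intro map_idI[symmetric]) (auto simp: pos_lists_def intro: Suc_pred gr0I)
      have "ks \<in> odd_lists (j + m) m r"
        using ls shift[of ks] unfolding eq pos_lists_def odd_lists_def by auto
      then show "ls \<in> map Suc ` odd_lists (j + m) m r" using eq by blast
    qed
  qed
  moreover have "inj_on (map Suc) (odd_lists (j + m) m r)" by (simp add: inj_on_def)
  ultimately show ?thesis by (simp add: card_image card_odd_lists)
qed

text \<open>A list is determined by its nonzero part and the positions of its zeros, that is, it is a
  shuffle of the zeros with the nonzero part.\<close>

lemma card_insert_zeros:
  assumes "finite Y" and Y: "\<And>ys. ys \<in> Y \<Longrightarrow> 0 \<notin> set ys \<and> length ys = k"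
  shows "card {ks :: nat list. length ks = p + k \<and> filter (\<lambda>x. x \<noteq> 0) ks \<in> Y}
    = ((p + k) choose p) * card Y"
proof -
  have shuf: "{ks. length ks = p + k \<and> filter (\<lambda>x. x \<noteq> 0) ks = ys} = shuffles (replicate p 0) ys"
    if "ys \<in> Y" for ys
  proof -
    have "shuffles (replicate p 0) ys = partition (\<lambda>x. x = 0) -` {(replicate p 0, ys)}"
      using Y[OF that] by (intro inv_image_partition[symmetric]) (auto intro: gr0I)
    also have "\<dots> = {ks. length ks = p + k \<and> filter (\<lambda>x. x \<noteq> 0) ks = ys}"
    proof -
      have "filter (\<lambda>x. x = 0) ks = replicate p 0 \<longleftrightarrow> length ks = p + k"
        if "filter (\<lambda>x. x \<noteq> 0) ks = ys" for ks :: "nat list"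
      proof -
        have "length ks = length (filter (\<lambda>x. x = 0) ks) + k"
          using sum_length_filter_compl[of "\<lambda>x. x = 0" ks] Y[OF \<open>ys \<in> Y\<close>] that by simp
        moreover have "filter (\<lambda>x. x = 0) ks = replicate (length (filter (\<lambda>x. x = 0) ks)) 0"
          by (rule replicate_eqI) auto
        ultimately show ?thesis by (metis add_right_cancel length_replicate)
      qed
      then show ?thesis by (auto simp: o_def)
    qed
    finally show ?thesis ..
  qed
  let ?F = "\<lambda>ys. {ks. length ks = p + k \<and> filter (\<lambda>x. x \<noteq> 0) ks = ys}"
  have "{ks :: nat list. length ks = p + k \<and> filter (\<lambda>x. x \<noteq> 0) ks \<in> Y} = (\<Union>ys\<in>Y. ?F ys)"
    by blast
  also have "card \<dots> = (\<Sum>ys\<in>Y. card (?F ys))"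
  proof (rule card_UN_disjoint)
    show "\<forall>ys\<in>Y. finite (?F ys)" using shuf by (auto simp only: finite_shuffles)
  qed (use \<open>finite Y\<close> in auto)
  also have "\<dots> = (\<Sum>ys\<in>Y. (p + k) choose p)"
  proof (rule sum.cong[OF refl])
    fix ys assume ys: "ys \<in> Y"
    have disj: "set (replicate p 0) \<inter> set ys = {}"
      using Y[OF ys] by (auto simp: set_replicate_conv_if)
    have "card (shuffles (replicate p 0) ys) = (p + length ys) choose p"
      using card_disjoint_shuffles[of "replicate p 0" ys] disj by simp
    then show "card (?F ys) = (p + k) choose p"
      using Y[OF ys] by (simp only: shuf[OF ys])
  qed
  finally show ?thesis by simp
qed

lemma card_even_lists:
  "card {ks. length ks = s + m \<and> odds ks = j \<and> evens ks = m \<and> sum_list ks = j + 2 * m + 2 * r}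
    = ((s + m) choose s) * (s choose j) * ((r + (j + m) - 1) choose r)"
  (is "card ?S = _")
proof -
  have len: "length ks = odds ks + evens ks + length (filter (\<lambda>x. x = 0) ks)" for ks
    by (induction ks) auto
  show ?thesis
  proof (cases "j \<le> s")
    case False
    then have "length ks \<noteq> s + m" if "odds ks = j" "evens ks = m" for ks
      using len[of ks] that by linarith
    then have "?S = {}" by blast
    then have "card ?S = 0" by (simp only: card.empty)
    then show ?thesis using False by (simp add: binomial_eq_0)
  next
    case True
    define p where "p = s - j"
    have s: "s + m = p + (j + m)" using True by (simp add: p_def)
    have filt: "odds (filter (\<lambda>x. x \<noteq> 0) ks) = odds ks" "evens (filter (\<lambda>x. x \<noteq> 0) ks) = evens ks"
      "sum_list (filter (\<lambda>x. x \<noteq> 0) ks) = sum_list ks" for ks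
      by (induction ks) auto
    have Y: "0 \<notin> set ys \<and> length ys = j + m" if "ys \<in> pos_lists j m r" for ys
    proof -
      have ys: "0 \<notin> set ys" "odds ys = j" "evens ys = m"
        using that unfolding pos_lists_def by blast+
      then have "\<forall>x\<in>set ys. x \<noteq> 0" by metis
      then have "filter (\<lambda>x. x = 0) ys = []" by (rule filter_False)
      then show ?thesis using len[of ys] ys by simp
    qed
    have "pos_lists j m r \<subseteq>
        {ks. sum_list ks \<le> j + 2 * m + 2 * r \<and> length ks = j + m \<and> True}"
    proof
      fix ys assume "ys \<in> pos_lists j m r"
      then show "ys \<in> {ks. sum_list ks \<le> j + 2 * m + 2 * r \<and> length ks = j + m \<and> True}"
        using Y[of ys] unfolding pos_lists_def by simp
    qed
    then have fin: "finite (pos_lists j m r)"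
      using finite_lists_sum[of "j + 2 * m + 2 * r" "j + m" "\<lambda>_. True"] by (rule finite_subset)
    have "?S = {ks. length ks = p + (j + m) \<and> filter (\<lambda>x. x \<noteq> 0) ks \<in> pos_lists j m r}"
    proof (rule Collect_cong)
      fix ks
      show "(length ks = s + m \<and> odds ks = j \<and> evens ks = m \<and> sum_list ks = j + 2 * m + 2 * r)
          = (length ks = p + (j + m) \<and> filter (\<lambda>x. x \<noteq> 0) ks \<in> pos_lists j m r)"
        unfolding pos_lists_def s mem_Collect_eq filt by simp
    qed
    then have "card ?S = ((p + (j + m)) choose p) * card (pos_lists j m r)"
      using card_insert_zeros[OF fin Y] by (simp only:)
    \<comment> \<open>Choosing the nonzero positions and then the even ones among them is the same as choosing
      the even positions first and then the odd ones among the other \<open>s\<close>.\<close>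
    also have "((p + (j + m)) choose p) = ((s + m) choose (j + m))"
      unfolding s by (subst binomial_symmetric) auto
    also have "((s + m) choose (j + m)) * card (pos_lists j m r)
        = (((s + m) choose (j + m)) * ((j + m) choose m)) * ((r + (j + m) - 1) choose r)"
      by (simp add: card_pos_lists)
    also have "((s + m) choose (j + m)) * ((j + m) choose m) = ((s + m) choose m) * (s choose j)"
      using True by (subst choose_mult) auto
    also have "((s + m) choose m) = ((s + m) choose s)"
      by (subst binomial_symmetric) auto
    finally show ?thesis .
  qed
qed

section \<open>Summation\<close>

lemma card_eq_sum_card_fibres:
  assumes "finite A" "finite I" "h ` A \<subseteq> I"
  shows "card A = (\<Sum>i\<in>I. card {a \<in> A. h a = i})"
  using sum.group[OF assms, of "\<lambda>_. 1 :: nat"] by simp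

lemma sum_int_interval_eq:
  fixes f :: "int \<Rightarrow> int"
  shows "(\<Sum>t = 0..K. f t) = (\<Sum>t\<in>{t. int t \<le> K}. f (int t))"
  by (rule sum.reindex_bij_witness[of _ int nat]) auto

lemma finite_int_le: "finite {t. int t \<le> K}"
  by (rule finite_subset[of _ "{..nat K}"]) auto

lemma binom_int: "binom (int a) (int b) = int (a choose b)"
  by (auto simp: binom_def)

text \<open>The upper argument is \<open>-1\<close> if \<open>a = b = 0\<close>. Both sides are \<open>1\<close> then, since
  \<open>binom (-1) 0 = 1\<close> on the left and subtraction truncates on the right.\<close>

lemma binom_int_pred: "binom (int a + int b - 1) (int a) = int ((a + b - 1) choose a)"
proof (cases a)
  case (Suc a')
  then have "int a + int b - 1 = int (a + b - 1)" by simp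
  then show ?thesis by (metis binom_int)
qed (simp add: binom_def)

text \<open>Each entry equals a pair count doubled plus \<open>0\<close>, \<open>1\<close> or \<open>2\<close>, according as it is zero, odd or
  positive even. Hence the number \<open>r\<close> of pairs is well defined.\<close>

lemma sum_list_parity: "\<exists>r. sum_list ks = odds ks + 2 * evens ks + 2 * r"
proof (induction ks)
  case (Cons k ks)
  then obtain r where r: "sum_list ks = odds ks + 2 * evens ks + 2 * r" by blast
  consider "k = 0" | q where "k = 2 * q + 1" | q where "k = 2 * q + 2"
  proof (cases "even k")
    case True
    then obtain c where "k = 2 * c" by blast
    then show thesis using that(1) that(3)[of "c - 1"] by (cases c) auto
  qed (use that(2) in \<open>blast elim: oddE\<close>)
  then show ?case
  proof cases
    case 1
    then show ?thesis using r by auto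
  next
    case 2
    then have "sum_list (k # ks) = odds (k # ks) + 2 * evens (k # ks) + 2 * (r + q)" using r by auto
    then show ?thesis ..
  next
    case 3
    then have "sum_list (k # ks) = odds (k # ks) + 2 * evens (k # ks) + 2 * (r + q)" using r by auto
    then show ?thesis ..
  qed
qed simp

text \<open>The fibres are taken over the number \<open>t\<close> of pairs. Its upper bound holds because a list has at
  least as many entries as odd entries.\<close>

lemma w_odd_formula:
  "int (w_odd n m) =
     (\<Sum>t = 0..(int n - 2 * int m + 1) div 2.
        binom (int n - int m - 2 * t + 1) (int m) * binom (int n - int m - t) t)"
proof -
  let ?A = "{ks. sum_list ks + length ks = Suc n \<and> odds ks = m}"
  let ?h = "\<lambda>ks. (sum_list ks - odds ks) div 2"
  let ?T = "{t. int t \<le> (int n - 2 * int m + 1) div 2}"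
  have h: "sum_list ks = odds ks + 2 * ?h ks" for ks
    using sum_list_parity[of ks] by auto
  have "card ?A = (\<Sum>t\<in>?T. card {ks \<in> ?A. ?h ks = t})"
  proof (rule card_eq_sum_card_fibres)
    show "finite ?A" by (rule finite_block_lists)
    show "finite ?T" by (rule finite_int_le)
    show "?h ` ?A \<subseteq> ?T"
    proof
      fix t assume "t \<in> ?h ` ?A"
      then obtain ks where ks: "ks \<in> ?A" "t = ?h ks" by blast
      have "odds ks \<le> length ks" by simp
      moreover have "sum_list ks + length ks = Suc n" "odds ks = m" using ks(1) by simp_all
      ultimately have "2 * t + 2 * m \<le> Suc n" using ks(2) h[of ks] by linarith
      then show "t \<in> ?T" by simp
    qed
  qed
  moreover have "int (card {ks \<in> ?A. ?h ks = t}) =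
      binom (int n - int m - 2 * int t + 1) (int m) * binom (int n - int m - int t) (int t)"
    if "t \<in> ?T" for t
  proof -
    define J where "J = Suc n - m - 2 * t"
    have "2 * t + 2 * m \<le> Suc n" using that by auto
    then have J: "Suc n = J + m + 2 * t" unfolding J_def by linarith
    have "{ks \<in> ?A. ?h ks = t} = odd_lists J m t"
    proof (intro set_eqI iffI)
      fix ks assume "ks \<in> {ks \<in> ?A. ?h ks = t}"
      then show "ks \<in> odd_lists J m t" using h[of ks] J by (auto simp: odd_lists_def)
    next
      fix ks assume "ks \<in> odd_lists J m t"
      then show "ks \<in> {ks \<in> ?A. ?h ks = t}" using J by (auto simp: odd_lists_def)
    qed
    then have "int (card {ks \<in> ?A. ?h ks = t}) = int (J choose m) * int ((t + J - 1) choose t)"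
      by (simp add: card_odd_lists)
    also have "\<dots> = binom (int J) (int m) * binom (int t + int J - 1) (int t)"
      by (simp only: binom_int binom_int_pred)
    also have "int J = int n - int m - 2 * int t + 1" using J by linarith
    also have "int t + (int n - int m - 2 * int t + 1) - 1 = int n - int m - int t" by simp
    finally show ?thesis .
  qed
  ultimately show ?thesis by (simp add: w_odd_blocks sum_int_interval_eq)
qed

text \<open>The fibres are taken over the number \<open>r\<close> of pairs beyond the minimal lengths \<open>1\<close> and \<open>2\<close>, and
  the number \<open>s\<close> of entries that are zero or odd.\<close>

lemma w_even_formula:
  "int (w_even n m) =
     (\<Sum>r = 0..(int n - 3 * int m + 1) div 2.
        \<Sum>s = 0..int n - 2 * r - 3 * int m + 1.
          binom (s + int m) s
          * binom s (int n - 2 * r - s - 3 * int m + 1)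
          * binom (int n - r - s - 2 * int m) r)"
proof -
  let ?A = "{ks. sum_list ks + length ks = Suc n \<and> evens ks = m}"
  let ?r = "\<lambda>ks. (sum_list ks - odds ks - 2 * evens ks) div 2"
  let ?s = "\<lambda>ks. length ks - evens ks"
  let ?R = "{r. int r \<le> (int n - 3 * int m + 1) div 2}"
  let ?S = "\<lambda>r. {s. int s \<le> int n - 2 * int r - 3 * int m + 1}"
  have r: "sum_list ks = odds ks + 2 * evens ks + 2 * ?r ks" for ks
    using sum_list_parity[of ks] by auto
  have s: "length ks = ?s ks + evens ks" for ks by simp
  have "card ?A = (\<Sum>(r, s)\<in>Sigma ?R ?S. card {ks \<in> ?A. (?r ks, ?s ks) = (r, s)})"
    unfolding split_def prod.collapse
  proof (rule card_eq_sum_card_fibres)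
    show "finite ?A" by (rule finite_block_lists)
    show "finite (Sigma ?R ?S)" by (intro finite_SigmaI finite_int_le)
    show "(\<lambda>ks. (?r ks, ?s ks)) ` ?A \<subseteq> Sigma ?R ?S"
    proof
      fix x assume "x \<in> (\<lambda>ks. (?r ks, ?s ks)) ` ?A"
      then obtain ks where ks: "ks \<in> ?A" and x: "x = (?r ks, ?s ks)" by blast
      have "odds ks + 2 * m + 2 * ?r ks + ?s ks + m = Suc n"
        using ks r[of ks] s[of ks] by simp
      then have "int (?s ks) \<le> int n - 2 * int (?r ks) - 3 * int m + 1"
        "2 * int (?r ks) \<le> int n - 3 * int m + 1" by linarith+
      then show "x \<in> Sigma ?R ?S" using x by auto
    qed
  qed
  also have "\<dots> = (\<Sum>r\<in>?R. \<Sum>s\<in>?S r. card {ks \<in> ?A. (?r ks, ?s ks) = (r, s)})"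
    by (rule sum.Sigma[symmetric]) (auto intro: finite_int_le)
  finally have sum_fibres: "int (w_even n m) =
      (\<Sum>r\<in>?R. \<Sum>s\<in>?S r. int (card {ks \<in> ?A. (?r ks, ?s ks) = (r, s)}))"
    by (simp add: w_even_blocks)
  have fibre: "int (card {ks \<in> ?A. (?r ks, ?s ks) = (r, s)}) =
      binom (int s + int m) (int s)
      * binom (int s) (int n - 2 * int r - int s - 3 * int m + 1)
      * binom (int n - int r - int s - 2 * int m) (int r)"
    if "s \<in> ?S r" for r s
  proof -
    have "s + 3 * m + 2 * r \<le> Suc n" using that by auto
    then obtain j where j: "Suc n = s + 3 * m + 2 * r + j"
      using le_Suc_ex by blast
    have "{ks \<in> ?A. (?r ks, ?s ks) = (r, s)} =
        {ks. length ks = s + m \<and> odds ks = j \<and> evens ks = m \<and> sum_list ks = j + 2 * m + 2 * r}"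
      (is "?L = ?M")
    proof (intro set_eqI iffI)
      fix ks assume "ks \<in> ?L"
      then show "ks \<in> ?M" using r[of ks] s[of ks] j by auto
    next
      fix ks assume "ks \<in> ?M"
      then show "ks \<in> ?L" using j by auto
    qed
    then have "int (card {ks \<in> ?A. (?r ks, ?s ks) = (r, s)}) =
        int ((s + m) choose s) * int (s choose j) * int ((r + (j + m) - 1) choose r)"
      by (simp only: card_even_lists of_nat_mult)
    also have "\<dots> = binom (int (s + m)) (int s) * binom (int s) (int j)
        * binom (int r + int (j + m) - 1) (int r)"
      by (simp only: binom_int binom_int_pred)
    also have "int j = int n - 2 * int r - int s - 3 * int m + 1" using j by linarith
    also have "int r + int (j + m) - 1 = int n - int r - int s - 2 * int m" using j by linarith
    finally show ?thesis by simp
  qed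
  show ?thesis
    unfolding sum_fibres sum_int_interval_eq
    by (rule sum.cong[OF refl], rule sum.cong[OF refl], rule fibre)
qed

theorem mainTheorem9:
  fixes n m :: nat
  assumes "n \<ge> 1"
  shows "int (w_odd n m) =
           (\<Sum>t = 0..(int n - 2 * int m + 1) div 2.
              binom (int n - int m - 2 * t + 1) (int m) * binom (int n - int m - t) t)
       \<and> int (w_even n m) =
           (\<Sum>r = 0..(int n - 3 * int m + 1) div 2.
              \<Sum>s = 0..int n - 2 * r - 3 * int m + 1.
                binom (s + int m) s
                * binom s (int n - 2 * r - s - 3 * int m + 1)
                * binom (int n - r - s - 2 * int m) r)"
  using w_odd_formula w_even_formula by blast

end
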